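(* Let $(\Omega,T)$ be a subshift over a finite alphabet $A\subset\mathbb{R}$ satisfying (PW). Then the function $M^E$ is uniform for each $E\in\mathbb{R}$.
   Context: Let $A\subset\mathbb{R}$ be finite with the discrete topology, $A^{\mathbb{Z}}$ with the product topology, and $T$ the shift $(Ta)(n)=a(n+1)$. A subshift is a closed $T$-invariant set $\Omega\subset A^{\mathbb{Z}}$. Let $\mathcal{W}$ be the set of all finite subwords of elements of $\Omega$; $|x|$ denotes the length of a word $x$ and $\sharp_v(x)$ the number of occurrences of the word $v$ in $x$. Condition (PW): there exists $C>0$ such that $\liminf_{|x|\to\infty,\,x\in\mathcal{W}}\frac{\sharp_v(x)}{|x|}|v|\ge C$ for every $v\in\mathcal{W}$. (Such subshifts are strictly ergodic.) For $E\in\mathbb{R}$ let $M^E(\omega)=\begin{pmatrix}E-\omega(1)&-1\\1&0\end{pmatrix}$ and $M^E(n,\omega)=M^E(T^{n-1}\omega)\cdots M^E(\omega)$ for $n>0$, $M^E(0,\omega)=\mathrm{Id}$, $M^E(n,\omega)=M^E(T^n\omega)^{-1}\cdots M^E(T^{-1}\omega)^{-1}$ for $n<0$. $M^E$ is called uniform if, with $\|\cdot\|$ the operator norm, the limit $\lim_{|n|\to\infty}\frac1{|n|}\log\|M^E(n,\omega)\|$ exists for every $\omega\in\Omega$ and the convergence is uniform on $\Omega$. *)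

theory Defs
  imports "HOL-Analysis.Analysis"
begin

text \<open>Sequences over the alphabet are functions int => real; the product topology
  on int => real is the library instance from Function_Topology.\<close>

definition shift :: "(int \<Rightarrow> real) \<Rightarrow> int \<Rightarrow> real" where
  "shift \<omega> = (\<lambda>n. \<omega> (n + 1))"

text \<open>k-fold power of the shift, for integer k: (T^k w)(n) = w(n+k).\<close>
definition shiftpow :: "int \<Rightarrow> (int \<Rightarrow> real) \<Rightarrow> int \<Rightarrow> real" where
  "shiftpow k \<omega> = (\<lambda>n. \<omega> (n + k))"

definition subshift :: "real set \<Rightarrow> (int \<Rightarrow> real) set \<Rightarrow> bool" where
  "subshift A \<Omega> \<longleftrightarrow> \<Omega> \<subseteq> {\<omega>. \<forall>n. \<omega> n \<in> A} \<and> closed \<Omega> \<and> shift ` \<Omega> = \<Omega>"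

text \<open>The word of length n of omega starting at position m.\<close>
definition word_at :: "(int \<Rightarrow> real) \<Rightarrow> int \<Rightarrow> nat \<Rightarrow> real list" where
  "word_at \<omega> m n = map (\<lambda>i. \<omega> (m + int i)) [0..<n]"

text \<open>Nonempty finite subwords of elements of Omega.\<close>
definition subwords :: "(int \<Rightarrow> real) set \<Rightarrow> real list set" where
  "subwords \<Omega> = {word_at \<omega> m n | \<omega> m n. \<omega> \<in> \<Omega> \<and> n \<ge> 1}"

definition occurrences :: "real list \<Rightarrow> real list \<Rightarrow> nat" where
  "occurrences v x = card {i. i + length v \<le> length x \<and> take (length v) (drop i x) = v}"

text \<open>Condition (PW): liminf over |x| -> infinity, x in W, of
  occurrences v x / |x| * |v| is at least C, for every v in W.\<close>
definition PW :: "(int \<Rightarrow> real) set \<Rightarrow> bool" where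
  "PW \<Omega> \<longleftrightarrow> (\<exists>C>0. \<forall>v\<in>subwords \<Omega>. \<forall>\<epsilon>>0. \<exists>N. \<forall>x\<in>subwords \<Omega>. length x \<ge> N \<longrightarrow>
      real (occurrences v x) / real (length x) * real (length v) \<ge> C - \<epsilon>)"

definition transfer :: "real \<Rightarrow> (int \<Rightarrow> real) \<Rightarrow> real^2^2" where
  "transfer E \<omega> = (\<chi> i j. if i = 1 \<and> j = 1 then E - \<omega> 1
                          else if i = 1 \<and> j = 2 then -1
                          else if i = 2 \<and> j = 1 then 1 else 0)"

fun cocycle_pos :: "real \<Rightarrow> nat \<Rightarrow> (int \<Rightarrow> real) \<Rightarrow> real^2^2" where
  "cocycle_pos E 0 \<omega> = mat 1"
| "cocycle_pos E (Suc k) \<omega> = transfer E (shiftpow (int k) \<omega>) ** cocycle_pos E k \<omega>"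

fun cocycle_neg :: "real \<Rightarrow> nat \<Rightarrow> (int \<Rightarrow> real) \<Rightarrow> real^2^2" where
  "cocycle_neg E 0 \<omega> = mat 1"
| "cocycle_neg E (Suc k) \<omega> =
     matrix_inv (transfer E (shiftpow (- int (Suc k)) \<omega>)) ** cocycle_neg E k \<omega>"

text \<open>M^E(n, omega) for integer n.\<close>
definition cocycle :: "real \<Rightarrow> int \<Rightarrow> (int \<Rightarrow> real) \<Rightarrow> real^2^2" where
  "cocycle E n \<omega> = (if n \<ge> 0 then cocycle_pos E (nat n) \<omega> else cocycle_neg E (nat (- n)) \<omega>)"

text \<open>Uniformity: (1/|n|) log ||M^E(n,w)|| converges as |n| -> infinity,
  uniformly in w in Omega (operator norm w.r.t. the Euclidean norm).\<close>
definition uniform_cocycle :: "(int \<Rightarrow> real) set \<Rightarrow> real \<Rightarrow> bool" where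
  "uniform_cocycle \<Omega> E \<longleftrightarrow> (\<exists>L. uniform_limit \<Omega>
      (\<lambda>n \<omega>. ln (onorm (\<lambda>x. cocycle E n \<omega> *v x)) / real_of_int \<bar>n\<bar>) L (sup at_top at_bot))"

end

theory Submission
  imports Defs
begin

(* The heart is a uniform subadditive theorem for languages with positive weights:
   if F is subadditive on words, satisfies F x <= F (x y) + F y and grows at most linearly, then
   F x / |x| converges uniformly on the language to the infimum Lambda of all slopes r with
   F x <= r |x| + D. The upper bound is immediate. For the lower bound, a long word v with
   F v < (Lambda - delta) |v| is cut to a long prefix w which, by (PW) and an analysis of the
   small periods of v, occurs disjointly with positive density in every long word y; splitting y
   along these occurrences then gives a slope below Lambda. The theorem follows with
   F x = ln (4 ||M^E(x)||) for the transfer matrix M^E(x) over the word x, since ln ||M^E(n, omega)||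
   differs from F by a bounded amount. *)

section \<open>Occurrences and periods of words\<close>

definition occs :: "'a list \<Rightarrow> 'a list \<Rightarrow> nat set" where
  "occs v x = {i. i + length v \<le> length x \<and> take (length v) (drop i x) = v}"

lemma occurrences_eq_card_occs: "occurrences v x = card (occs v x)"
  unfolding occurrences_def occs_def ..

lemma finite_occs [simp]: "finite (occs v x)"
  by (rule finite_subset[of _ "{..length x}"]) (auto simp: occs_def)

lemma mem_occs_iff:
  "i \<in> occs v x \<longleftrightarrow> i + length v \<le> length x \<and> (\<forall>k<length v. x ! (i + k) = v ! k)"
  by (auto simp: occs_def list_eq_iff_nth_eq)

lemma mem_occs_take:
  assumes "j \<in> occs w y" "j + length w \<le> i"
  shows "j \<in> occs w (take i y)"
  using assms by (simp add: mem_occs_iff)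

definition separated :: "nat \<Rightarrow> nat set \<Rightarrow> bool" where
  "separated l S \<longleftrightarrow> (\<forall>i\<in>S. \<forall>j\<in>S. i < j \<longrightarrow> i + l \<le> j)"

definition disjoint_occs :: "'a list \<Rightarrow> 'a list \<Rightarrow> nat \<Rightarrow> bool" where
  "disjoint_occs w y m \<longleftrightarrow> (\<exists>S\<subseteq>occs w y. card S = m \<and> separated (length w) S)"

lemma card_separated_window:
  assumes "separated s P" "0 < s" "l \<le> K * s"
  shows "card {q\<in>P. a \<le> q \<and> q < a + l} \<le> K"
proof -
  let ?Q = "{q\<in>P. a \<le> q \<and> q < a + l}" and ?f = "\<lambda>q. (q - a) div s"
  have "inj_on ?f ?Q"
  proof (rule linorder_inj_onI')
    fix q q' assume q: "q \<in> ?Q" and q': "q' \<in> ?Q" and "q < q'"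
    then have "q + s \<le> q'"
      using assms(1) unfolding separated_def by blast
    then have "q - a + s \<le> q' - a"
      using q by simp
    then have "?f q + 1 \<le> ?f q'"
      using div_le_mono[of "q - a + s" "q' - a" s] assms(2) by simp
    then show "?f q \<noteq> ?f q'"
      by simp
  qed
  moreover have "?f ` ?Q \<subseteq> {..<K}"
  proof
    fix z assume "z \<in> ?f ` ?Q"
    then obtain q where "q \<in> ?Q" "z = ?f q"
      by blast
    then have "q - a < K * s" "z = ?f q"
      using assms(3) by auto
    then show "z \<in> {..<K}"
      using assms(2) by (simp add: div_less_iff_less_mult)
  qed
  ultimately have "card ?Q \<le> card {..<K}"
    by (intro card_inj_on_le) simp_all
  then show ?thesis
    by simp
qed

text \<open>Greedy selection: keep the leftmost position and discard the window of length \<open>l\<close> after it.\<close>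

lemma separated_subset:
  assumes "finite P" "separated s P" "0 < s" "l \<le> K * s" "0 < l"
  shows "\<exists>S\<subseteq>P. separated l S \<and> card P \<le> K * card S"
  using assms(1,2)
proof (induction "card P" arbitrary: P rule: less_induct)
  case less
  show ?case
  proof (cases "P = {}")
    case True
    then show ?thesis
      by (simp add: separated_def)
  next
    case False
    define p where "p = Min P"
    have p: "p \<in> P" "\<And>q. q \<in> P \<Longrightarrow> p \<le> q"
      using False less.prems(1) by (simp_all add: p_def)
    define Q where "Q = {q\<in>P. p + l \<le> q}"
    have QP: "Q \<subseteq> P" "p \<notin> Q"
      using assms(5) by (auto simp: Q_def)
    have "finite Q"
      using QP(1) less.prems(1) by (rule finite_subset)
    moreover have "card Q < card P"
      using QP p(1) less.prems(1) by (intro psubset_card_mono) auto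
    moreover have "separated s Q"
      using QP(1) less.prems(2) by (auto simp: separated_def)
    ultimately obtain S where S: "S \<subseteq> Q" "separated l S" "card Q \<le> K * card S"
      using less.hyps by blast
    have "finite S"
      using S(1) \<open>finite Q\<close> by (rule finite_subset)
    have "p \<notin> S"
      using S(1) QP(2) by blast
    have "separated l (insert p S)"
      using S(1,2) p(2) QP(1) unfolding separated_def Q_def by auto
    have "P = {q\<in>P. p \<le> q \<and> q < p + l} \<union> Q"
      using p(2) by (auto simp: Q_def)
    then have "card P \<le> card {q\<in>P. p \<le> q \<and> q < p + l} + card Q"
      by (metis card_Un_le)
    also have "\<dots> \<le> K * card (insert p S)"
      using card_separated_window[OF less.prems(2) assms(3,4), of p] S(3)
        \<open>finite S\<close> \<open>p \<notin> S\<close> by simp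
    finally show ?thesis
      using S(1) p(1) QP(1) \<open>separated l (insert p S)\<close> by blast
  qed
qed

lemma disjoint_occs_append_left:
  assumes "disjoint_occs w y m"
  shows "disjoint_occs w (x @ y) m"
proof -
  obtain S where S: "S \<subseteq> occs w y" "card S = m" "separated (length w) S"
    using assms unfolding disjoint_occs_def by blast
  let ?T = "(\<lambda>i. i + length x) ` S"
  have "i + length x \<in> occs w (x @ y)" if "i \<in> S" for i
  proof -
    have "i + length w \<le> length y" "\<And>k. k < length w \<Longrightarrow> y ! (i + k) = w ! k"
      using that S(1) by (auto simp: mem_occs_iff)
    then show ?thesis
      by (simp add: mem_occs_iff nth_append add.assoc[symmetric] add.commute[of _ "length x"])
  qed
  then have "?T \<subseteq> occs w (x @ y)"
    by blast
  moreover have "card ?T = m"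
    using S(2) by (simp add: card_image)
  moreover have "separated (length w) ?T"
    using S(3) by (auto simp: separated_def)
  ultimately show ?thesis
    unfolding disjoint_occs_def by blast
qed

lemma occs_trans:
  assumes "i \<in> occs u y" "j \<in> occs w u"
  shows "i + j \<in> occs w y"
proof -
  have occ: "i + length u \<le> length y" "j + length w \<le> length u"
    "\<And>k. k < length u \<Longrightarrow> y ! (i + k) = u ! k" "\<And>k. k < length w \<Longrightarrow> u ! (j + k) = w ! k"
    using assms by (simp_all add: mem_occs_iff)
  show ?thesis
    unfolding mem_occs_iff
  proof (intro conjI allI impI)
    show "i + j + length w \<le> length y"
      using occ(1,2) by simp
    fix k assume "k < length w"
    then have "y ! (i + (j + k)) = u ! (j + k)" "u ! (j + k) = w ! k"
      using occ by simp_all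
    then show "y ! (i + j + k) = w ! k"
      by (simp add: add.assoc)
  qed
qed

lemma separated_add_le:
  assumes "separated l S" "separated s K" "\<forall>j\<in>K. j + s \<le> l"
    and "i \<in> S" "j \<in> K" "i' \<in> S" "j' \<in> K" "i < i' \<or> i = i' \<and> j < j'"
  shows "i + j + s \<le> i' + j'"
proof (cases "i < i'")
  case True
  then have "i + l \<le> i'"
    using assms(1,4,6) unfolding separated_def by blast
  then show ?thesis
    using assms(3,5) by fastforce
next
  case False
  then show ?thesis
    using assms(2,5,7,8) unfolding separated_def by auto
qed

lemma separated_add_less_iff:
  assumes "separated l S" "separated s K" "\<forall>j\<in>K. j + s \<le> l" "0 < s"
    and "i \<in> S" "j \<in> K" "i' \<in> S" "j' \<in> K"
  shows "i + j < i' + j' \<longleftrightarrow> i < i' \<or> i = i' \<and> j < j'"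
proof
  assume lt: "i + j < i' + j'"
  show "i < i' \<or> i = i' \<and> j < j'"
  proof (rule ccontr)
    assume "\<not> (i < i' \<or> i = i' \<and> j < j')"
    then have "i' < i \<or> i' = i \<and> j' \<le> j"
      by auto
    then show False
      using separated_add_le[OF assms(1-3,7,8,5,6)] lt by (cases "i' < i") auto
  qed
next
  assume "i < i' \<or> i = i' \<and> j < j'"
  then show "i + j < i' + j'"
    using separated_add_le[OF assms(1-3,5-8)] assms(4) by simp
qed

lemma disjoint_occs_trans:
  assumes "disjoint_occs u y m" "disjoint_occs w u k" "w \<noteq> []"
  shows "disjoint_occs w y (m * k)"
proof -
  obtain S where S: "S \<subseteq> occs u y" "card S = m" "separated (length u) S"
    using assms(1) unfolding disjoint_occs_def by blast
  obtain K where K: "K \<subseteq> occs w u" "card K = k" "separated (length w) K"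
    using assms(2) unfolding disjoint_occs_def by blast
  have K_le: "\<forall>j\<in>K. j + length w \<le> length u"
    using K(1) by (auto simp: mem_occs_iff)
  note lex_iff = separated_add_less_iff[OF S(3) K(3) K_le]
  let ?f = "\<lambda>(i, j). i + j :: nat"
  have inj: "inj_on ?f (S \<times> K)"
  proof (rule inj_onI, clarify)
    fix i j i' j' assume "i \<in> S" "j \<in> K" "i' \<in> S" "j' \<in> K" "i + j = i' + j'"
    then have "\<not> (i < i' \<or> i = i' \<and> j < j')" "\<not> (i' < i \<or> i' = i \<and> j' < j)"
      using lex_iff[of i j i' j'] lex_iff[of i' j' i j] assms(3) by simp_all
    then show "i = i' \<and> j = j'"
      by auto
  qed
  have "?f ` (S \<times> K) \<subseteq> occs w y"
    using S(1) K(1) occs_trans by fastforce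
  moreover have "card (?f ` (S \<times> K)) = m * k"
    using inj S(2) K(2) by (simp add: card_image card_cartesian_product)
  moreover have "separated (length w) (?f ` (S \<times> K))"
    unfolding separated_def
  proof clarify
    fix i j i' j' assume "i \<in> S" "j \<in> K" "i' \<in> S" "j' \<in> K" "i + j < i' + j'"
    then show "i + j + length w \<le> i' + j'"
      using separated_add_le[OF S(3) K(3) K_le] lex_iff assms(3) by simp
  qed
  ultimately show ?thesis
    unfolding disjoint_occs_def by blast
qed

lemma disjoint_occs_SucE:
  assumes "disjoint_occs w y (Suc m)"
  obtains i where "i + length w \<le> length y" "y = take i y @ w @ drop (i + length w) y"
    "disjoint_occs w (take i y) m"
proof -
  obtain S where S: "S \<subseteq> occs w y" "card S = Suc m" "separated (length w) S"
    using assms unfolding disjoint_occs_def by blast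
  have "finite S"
    using S(1) by (rule finite_subset) simp
  define i where "i = Max S"
  have "S \<noteq> {}"
    using S(2) by auto
  then have i: "i \<in> S" "\<And>j. j \<in> S \<Longrightarrow> j \<le> i"
    using \<open>finite S\<close> by (simp_all add: i_def)
  have "i \<in> occs w y"
    using S(1) i(1) by blast
  then have "take (length w) (drop i y) = w" "i + length w \<le> length y"
    by (simp_all add: occs_def)
  then have y_eq: "y = take i y @ w @ drop (i + length w) y"
    by (metis append_take_drop_id drop_drop add.commute)
  have "S - {i} \<subseteq> occs w (take i y)"
  proof
    fix j assume j: "j \<in> S - {i}"
    then have "j < i"
      using i(2) by force
    then have "j + length w \<le> i"
      using S(3) i(1) j unfolding separated_def by blast
    then show "j \<in> occs w (take i y)"
      using S(1) j by (intro mem_occs_take) blast+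
  qed
  moreover have "card (S - {i}) = m"
    using S(2) i(1) \<open>finite S\<close> by simp
  moreover have "separated (length w) (S - {i})"
    using S(3) unfolding separated_def by blast
  ultimately have "disjoint_occs w (take i y) m"
    unfolding disjoint_occs_def by blast
  then show ?thesis
    using that \<open>i + length w \<le> length y\<close> y_eq by blast
qed

definition periodic :: "nat \<Rightarrow> 'a list \<Rightarrow> bool" where
  "periodic d z \<longleftrightarrow> (\<forall>k. k + d < length z \<longrightarrow> z ! k = z ! (k + d))"

lemma periodicD:
  assumes "periodic d z" "k + d < length z"
  shows "z ! (k + d) = z ! k"
  using assms unfolding periodic_def by simp

lemma periodic_nth_add_mult:
  assumes "periodic d z" "a + q * d < length z"
  shows "z ! (a + q * d) = z ! a"
  using assms(2)
proof (induction q)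
  case (Suc q)
  have eq: "a + Suc q * d = a + q * d + d"
    by simp
  have "z ! (a + q * d + d) = z ! (a + q * d)"
    using Suc.prems unfolding eq by (rule periodicD[OF assms(1)])
  then have "z ! (a + Suc q * d) = z ! (a + q * d)"
    by (simp only: eq)
  also have "\<dots> = z ! a"
    using Suc by simp
  finally show ?case .
qed simp

lemma periodic_nth_mod_eq:
  assumes "periodic d z" "a < length z" "b < length z" "a mod d = b mod d"
  shows "z ! a = z ! b"
proof -
  have ordered: "z ! a = z ! b" if ab: "a \<le> b" "b < length z" "a mod d = b mod d" for a b
  proof -
    obtain q where "b = a + d * q"
      using ab(3,1) by (rule mod_eq_nat2E)
    then have "b = a + q * d"
      by (simp add: mult.commute)
    then show ?thesis
      using periodic_nth_add_mult[OF assms(1), of a q] ab(2) by simp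
  qed
  show ?thesis
  proof (cases "a \<le> b")
    case True
    then show ?thesis
      using ordered assms(3,4) by blast
  next
    case False
    then show ?thesis
      using ordered[of b a] assms(2,4) by simp
  qed
qed

lemma periodic_mod_mem_occs:
  assumes "periodic d y" "0 < d" "t \<in> occs w y"
  shows "t mod d \<in> occs w y"
  unfolding mem_occs_iff
proof (intro conjI allI impI)
  have "t mod d \<le> t" "t + length w \<le> length y"
    using assms(3) by (simp_all add: mem_occs_iff)
  then show "t mod d + length w \<le> length y"
    by linarith
  fix k assume "k < length w"
  then have "t + k < length y"
    using assms(3) by (simp add: mem_occs_iff)
  then have "t mod d + k < length y" "t + k < length y"
    using \<open>t mod d \<le> t\<close> by linarith+
  then have "y ! (t mod d + k) = y ! (t + k)"
    by (intro periodic_nth_mod_eq[OF assms(1)]) (simp_all add: mod_add_left_eq)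
  also have "\<dots> = w ! k"
    using assms(3) \<open>k < length w\<close> by (simp add: mem_occs_iff)
  finally show "y ! (t mod d + k) = w ! k" .
qed

lemma periodic_subword:
  assumes "periodic d z"
  shows "periodic d (take n (drop i z))"
  unfolding periodic_def
proof (intro allI impI)
  fix k assume "k + d < length (take n (drop i z))"
  then have "i + k + d < length z" "k + d < n"
    by auto
  then show "take n (drop i z) ! k = take n (drop i z) ! (k + d)"
    using periodicD[OF assms, of "i + k"] by (simp add: add.assoc)
qed

lemma periodic_drop:
  assumes "periodic d z"
  shows "periodic d (drop i z)"
  using periodic_subword[OF assms, of "length z" i] by simp

lemma disjoint_occs_periodic:
  assumes "periodic d z" "d dvd n" "0 < n"
  shows "disjoint_occs (take n z) z (length z div n)"
proof (cases "n \<le> length z")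
  case False
  then have "length z div n = 0"
    by simp
  then show ?thesis
    unfolding disjoint_occs_def separated_def by (intro exI[of _ "{}"]) simp
next
  case True
  obtain r where r: "n = r * d"
    using assms(2) by (metis dvd_def mult.commute)
  let ?S = "(\<lambda>j. j * n) ` {..<length z div n}"
  have "j * n \<in> occs (take n z) z" if j: "j < length z div n" for j
    unfolding mem_occs_iff
  proof (intro conjI allI impI)
    have "Suc j * n \<le> length z div n * n"
      using j by (intro mult_le_mono1) simp
    also have "\<dots> \<le> length z"
      by (metis div_mult_mod_eq le_add1)
    finally show jn: "j * n + length (take n z) \<le> length z"
      using True by simp
    fix k assume k: "k < length (take n z)"
    have eq: "j * n + k = k + (j * r) * d"
      by (simp add: r algebra_simps)
    have "z ! (k + (j * r) * d) = z ! k"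
      using jn k True by (intro periodic_nth_add_mult[OF assms(1)]) (subst eq[symmetric], simp)
    then show "z ! (j * n + k) = take n z ! k"
      using k unfolding eq by simp
  qed
  then have "?S \<subseteq> occs (take n z) z"
    by blast
  moreover have "card ?S = length z div n"
    using assms(3) by (simp add: card_image inj_on_def)
  moreover have "separated (length (take n z)) ?S"
    unfolding separated_def
  proof clarify
    fix j j' assume "j * n < j' * n"
    then have "Suc j * n \<le> j' * n"
      by (intro mult_le_mono1) (simp add: Suc_le_eq)
    then show "j * n + length (take n z) \<le> j' * n"
      using True by simp
  qed
  ultimately show ?thesis
    unfolding disjoint_occs_def by blast
qed

lemma periodic_of_occs:
  assumes "i \<in> occs v y" "j \<in> occs v y" "i < j"
  shows "periodic (j - i) v"
  unfolding periodic_def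
proof (intro allI impI)
  fix k assume k: "k + (j - i) < length v"
  have "v ! (k + (j - i)) = y ! (i + (k + (j - i)))"
    using assms(1) k by (simp add: mem_occs_iff)
  also have "i + (k + (j - i)) = j + k"
    using assms(3) by simp
  also have "y ! (j + k) = v ! k"
    using assms(2) k by (simp add: mem_occs_iff)
  finally show "v ! k = v ! (k + (j - i))" ..
qed

lemma separated_occs_if_aperiodic:
  assumes "\<And>d. 0 < d \<Longrightarrow> d < s \<Longrightarrow> \<not> periodic d v"
  shows "separated s (occs v y)"
  unfolding separated_def
proof (intro ballI impI)
  fix i j assume "i \<in> occs v y" "j \<in> occs v y" "i < j"
  then have "periodic (j - i) v"
    by (rule periodic_of_occs)
  then have "\<not> j - i < s"
    using assms[of "j - i"] \<open>i < j\<close> by auto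
  then show "i + s \<le> j"
    using \<open>i < j\<close> by arith
qed

lemma periodic_overlapping_occs:
  assumes "periodic d u" "i \<in> occs u y" "j \<in> occs u y" "i \<le> j" "j + d \<le> i + length u"
  shows "periodic d (take (j + length u - i) (drop i y))"
  unfolding periodic_def
proof (intro allI impI)
  fix k assume k: "k + d < length (take (j + length u - i) (drop i y))"
  have iy: "y ! (i + k) = u ! k" if "k < length u" for k
    using assms(2) that by (simp add: mem_occs_iff)
  have jy: "y ! (j + k) = u ! k" if "k < length u" for k
    using assms(3) that by (simp add: mem_occs_iff)
  have "j + length u \<le> length y"
    using assms(3) by (simp add: mem_occs_iff)
  then have k': "k + d < j + length u - i" and nth: "\<And>k'. k' < j + length u - i \<Longrightarrow>
      take (j + length u - i) (drop i y) ! k' = y ! (i + k')"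
    using k assms(4) by auto
  show "take (j + length u - i) (drop i y) ! k = take (j + length u - i) (drop i y) ! (k + d)"
  proof (cases "k + d < length u")
    case True
    then have "take (j + length u - i) (drop i y) ! k = u ! k"
      using k' nth iy by simp
    also have "\<dots> = u ! (k + d)"
      using periodicD[OF assms(1) True] by simp
    also have "\<dots> = y ! (i + (k + d))"
      using iy True by simp
    also have "\<dots> = take (j + length u - i) (drop i y) ! (k + d)"
      using k' nth by simp
    finally show ?thesis .
  next
    case False
    \<comment> \<open>Past the first copy of \<open>u\<close>, both positions lie in the second one.\<close>
    define k'' where "k'' = k - (j - i)"
    have "i + k = j + k''" "k'' + d < length u"
      using False k' assms(4,5) by (auto simp: k''_def)
    then have "take (j + length u - i) (drop i y) ! k = u ! k''"
      using k' nth jy by simp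
    also have "\<dots> = u ! (k'' + d)"
      using periodicD[OF assms(1) \<open>k'' + d < length u\<close>] by simp
    also have "\<dots> = y ! (j + (k'' + d))"
      using jy \<open>k'' + d < length u\<close> by simp
    also have "\<dots> = y ! (i + (k + d))"
      using \<open>i + k = j + k''\<close> by (metis add.assoc)
    also have "\<dots> = take (j + length u - i) (drop i y) ! (k + d)"
      using k' nth by simp
    finally show ?thesis .
  qed
qed

lemma le_two_mult_div_mult:
  fixes l n :: nat
  assumes "0 < n" "n \<le> l"
  shows "l \<le> 2 * (l div n * n)"
proof -
  have "1 * n \<le> l div n * n"
    using assms by (intro mult_le_mono1) (simp add: Suc_le_eq div_greater_zero_iff)
  moreover have "l = l div n * n + l mod n" "l mod n < n"
    using assms(1) by simp_all
  ultimately show ?thesis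
    by linarith
qed

lemma le_two_mult_div_mult_drop:
  fixes l n t d :: nat
  assumes "0 < n" "t < d" "2 * (d + n) \<le> l"
  shows "l \<le> 2 * ((l - t) div n * n)"
proof -
  define q where "q = (l - t) div n"
  define r where "r = (l - t) mod n"
  have "l - t = q * n + r" "r < n"
    using assms(1) by (simp_all add: q_def r_def)
  then have "l < q * n + n + d"
    using assms(2) by linarith
  then show ?thesis
    using assms(3) by (simp add: q_def)
qed

lemma prefix_multiple_of_period:
  fixes L d k :: nat
  assumes "0 < d" "d \<le> L div k" "2 \<le> k"
  shows "0 < L div d * d" "(L - L div d * d) * k \<le> L" "2 * d \<le> L"
proof -
  have "d * k \<le> L div k * k"
    using assms(2) by (rule mult_le_mono1)
  also have "\<dots> \<le> L"
    by simp
  finally have "d * k \<le> L" .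
  moreover have "2 * d \<le> d * k"
    using assms(3) by (simp add: mult.commute)
  ultimately show "2 * d \<le> L"
    by linarith
  then show "0 < L div d * d"
    using assms(1) by (simp add: div_greater_zero_iff)
  have "L - L div d * d = L mod d"
    by (simp add: minus_div_mult_eq_mod)
  then have "(L - L div d * d) * k \<le> d * k"
    using assms(1) by (intro mult_le_mono1) simp
  then show "(L - L div d * d) * k \<le> L"
    using \<open>d * k \<le> L\<close> by linarith
qed

section \<open>Languages with positive weights\<close>

locale factorial_language =
  fixes W :: "'a list set"
  assumes subword_mem: "x \<in> W \<Longrightarrow> take n (drop i x) \<noteq> [] \<Longrightarrow> take n (drop i x) \<in> W"
    and Nil_notin: "[] \<notin> W"
    and unbounded: "\<exists>x\<in>W. n \<le> length x"
begin

lemma length_pos: "x \<in> W \<Longrightarrow> 0 < length x"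
  using Nil_notin by (cases x) auto

lemma take_mem: "x \<in> W \<Longrightarrow> 0 < n \<Longrightarrow> take n x \<in> W"
  using subword_mem[of x n 0] length_pos[of x] by simp

lemma drop_mem: "x \<in> W \<Longrightarrow> i < length x \<Longrightarrow> drop i x \<in> W"
  using subword_mem[of x "length x" i] by simp

lemma take_drop_mem_or_Nil:
  assumes "x \<in> W \<or> x = []"
  shows "take n (drop i x) \<in> W \<or> take n (drop i x) = []"
proof (cases "take n (drop i x) = []")
  case False
  then have "x \<in> W"
    using assms by auto
  then show ?thesis
    using subword_mem False by blast
qed simp

lemma take_mem_or_Nil: "x \<in> W \<or> x = [] \<Longrightarrow> take n x \<in> W \<or> take n x = []"
  using take_drop_mem_or_Nil[of x n 0] by simp

lemma drop_mem_or_Nil: "x \<in> W \<or> x = [] \<Longrightarrow> drop i x \<in> W \<or> drop i x = []"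
  using take_drop_mem_or_Nil[of x "length x" i] by simp

definition uniformly_covers :: "real \<Rightarrow> 'a list \<Rightarrow> bool" where
  "uniformly_covers \<theta> w \<longleftrightarrow> (\<exists>N. \<forall>y\<in>W. N \<le> length y \<longrightarrow>
     (\<exists>m. disjoint_occs w y m \<and> \<theta> * length y \<le> real (m * length w)))"

lemma uniformly_covers_mono:
  assumes "uniformly_covers \<theta> w" "\<theta>' \<le> \<theta>"
  shows "uniformly_covers \<theta>' w"
proof -
  have "\<theta>' * length y \<le> \<theta> * length y" for y :: "'a list"
    using assms(2) by (intro mult_right_mono) simp_all
  then show ?thesis
    using assms(1) unfolding uniformly_covers_def by (meson order_trans)
qed

lemma maximal_periodic_extension:
  assumes "v \<in> W" "periodic d v" "\<And>z. z \<in> W \<Longrightarrow> periodic d z \<Longrightarrow> length z < B"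
  obtains u where "u \<in> W" "periodic d u" "take (length v) u = v"
    "\<And>z. z \<in> W \<Longrightarrow> periodic d z \<Longrightarrow> take (length u) z = u \<Longrightarrow> length z \<le> length u"
proof -
  let ?U = "\<lambda>z. z \<in> W \<and> periodic d z \<and> take (length v) z = v"
  have "?U v" "\<forall>z. ?U z \<longrightarrow> length z < B"
    using assms by simp_all
  then obtain u where u: "?U u" and u_max: "\<And>z. ?U z \<Longrightarrow> length z \<le> length u"
    using ex_has_greatest_nat[of ?U v length B] by blast
  have "length (take (length v) u) = length v"
    using u by simp
  then have "length v \<le> length u"
    by simp
  have "length z \<le> length u" if "z \<in> W" "periodic d z" "take (length u) z = u" for z
  proof (rule u_max)
    have "take (length v) z = take (length v) (take (length u) z)"
      using \<open>length v \<le> length u\<close> by (simp add: min.absorb1)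
    then show "?U z"
      using that u by simp
  qed
  with u show ?thesis
    using that by blast
qed

lemma uniformly_covers_trans:
  assumes "uniformly_covers \<theta> u" "disjoint_occs w u k" "w \<noteq> []" "length u \<le> 2 * (k * length w)"
  shows "uniformly_covers (\<theta> / 2) w"
proof -
  obtain N where N: "\<forall>y\<in>W. N \<le> length y \<longrightarrow>
      (\<exists>m. disjoint_occs u y m \<and> \<theta> * length y \<le> real (m * length u))"
    using assms(1) unfolding uniformly_covers_def by blast
  have "\<exists>m'. disjoint_occs w y m' \<and> \<theta> / 2 * length y \<le> real (m' * length w)"
    if "y \<in> W" "N \<le> length y" for y
  proof -
    obtain m where m: "disjoint_occs u y m" "\<theta> * length y \<le> real (m * length u)"
      using N \<open>y \<in> W\<close> \<open>N \<le> length y\<close> by blast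
    have "m * length u \<le> 2 * (m * k * length w)"
      using mult_le_mono2[OF assms(4), of m] by (simp add: algebra_simps)
    then have "real (m * length u) \<le> real (2 * (m * k * length w))"
      by (rule of_nat_mono)
    then have "real (m * length u) \<le> 2 * real (m * k * length w)"
      by (simp only: of_nat_mult of_nat_numeral)
    then have "\<theta> / 2 * length y \<le> real (m * k * length w)"
      using m(2) by linarith
    moreover have "disjoint_occs w y (m * k)"
      using disjoint_occs_trans[OF m(1) assms(2,3)] .
    ultimately show ?thesis
      by blast
  qed
  then show ?thesis
    unfolding uniformly_covers_def by blast
qed

end

text \<open>\<open>C \<le> 1\<close> is only a normalisation: the density bound persists when \<open>C\<close> decreases.\<close>

locale pw_language = factorial_language W for W :: "'a list set" +
  fixes C :: real
  assumes C_pos: "0 < C" and C_le_1: "C \<le> 1"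
    and occurrence_density:
      "v \<in> W \<Longrightarrow> \<exists>N. \<forall>x\<in>W. N \<le> length x \<longrightarrow> C * length x \<le> real (card (occs v x) * length v)"
begin

lemma eventually_occurs:
  assumes "v \<in> W"
  shows "\<exists>N. \<forall>x\<in>W. N \<le> length x \<longrightarrow> occs v x \<noteq> {}"
proof -
  obtain N where N: "\<forall>x\<in>W. N \<le> length x \<longrightarrow> C * length x \<le> real (card (occs v x) * length v)"
    using occurrence_density[OF assms] by blast
  have "occs v x \<noteq> {}" if "x \<in> W" "N \<le> length x" for x
  proof -
    have "0 < C * length x"
      using C_pos length_pos[OF that(1)] by simp
    also have "\<dots> \<le> real (card (occs v x) * length v)"
      using N that by blast
    finally show ?thesis
      by auto
  qed
  then show ?thesis
    by blast
qed

text \<open>Every word of \<open>W\<close> occurs in every long word, so it inherits any period of arbitrarily long words.\<close>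

lemma periodic_if_long_periodic:
  assumes "\<And>B. \<exists>z\<in>W. B \<le> length z \<and> periodic d z" "x \<in> W"
  shows "periodic d x"
proof -
  obtain N where N: "\<forall>z\<in>W. N \<le> length z \<longrightarrow> occs x z \<noteq> {}"
    using eventually_occurs[OF assms(2)] by blast
  obtain z where z: "z \<in> W" "N \<le> length z" "periodic d z"
    using assms(1) by blast
  then have "occs x z \<noteq> {}"
    using N by blast
  then obtain i where "i \<in> occs x z"
    by blast
  then have "x = take (length x) (drop i z)"
    by (simp add: occs_def)
  then show ?thesis
    using periodic_subword[OF z(3), of "length x" i] by simp
qed

lemma uniformly_covers_if_separated_occs:
  assumes "u \<in> W" "0 < s" "length u \<le> K * s" "\<And>y. y \<in> W \<Longrightarrow> separated s (occs u y)"
  shows "uniformly_covers (C / K) u"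
proof -
  obtain N where N: "\<forall>y\<in>W. N \<le> length y \<longrightarrow> C * length y \<le> real (card (occs u y) * length u)"
    using occurrence_density[OF assms(1)] by blast
  have "0 < K"
    using assms(3) length_pos[OF assms(1)] by (cases K) simp_all
  have "\<exists>m. disjoint_occs u y m \<and> C / K * length y \<le> real (m * length u)"
    if y: "y \<in> W" "N \<le> length y" for y
  proof -
    obtain S where S: "S \<subseteq> occs u y" "separated (length u) S" "card (occs u y) \<le> K * card S"
      using separated_subset[OF finite_occs assms(4)[OF y(1)] assms(2,3) length_pos[OF assms(1)]]
      by blast
    have "disjoint_occs u y (card S)"
      using S(1,2) unfolding disjoint_occs_def by blast
    moreover have "C * length y \<le> K * real (card S * length u)"
    proof -
      have "C * length y \<le> real (card (occs u y) * length u)"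
        using N y by blast
      also have "\<dots> \<le> real (K * card S * length u)"
        using S(3) by (intro of_nat_mono mult_le_mono1)
      finally show ?thesis
        by (simp add: mult.assoc)
    qed
    then have "C / K * length y \<le> real (card S * length u)"
      using \<open>0 < K\<close> by (simp add: field_simps)
    ultimately show ?thesis
      by blast
  qed
  then show ?thesis
    unfolding uniformly_covers_def by blast
qed

text \<open>Two overlapping occurrences of a maximal \<open>d\<close>-periodic word would glue to a longer one.\<close>

lemma separated_occs_if_maximal_periodic:
  assumes "periodic d u" "d \<le> length u" "y \<in> W"
    and maximal: "\<And>z. z \<in> W \<Longrightarrow> periodic d z \<Longrightarrow> take (length u) z = u \<Longrightarrow> length z \<le> length u"
  shows "separated (length u - d + 1) (occs u y)"
  unfolding separated_def
proof (intro ballI impI)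
  fix i j assume i: "i \<in> occs u y" and j: "j \<in> occs u y" and "i < j"
  show "i + (length u - d + 1) \<le> j"
  proof (rule ccontr)
    assume "\<not> i + (length u - d + 1) \<le> j"
    then have overlap: "j + d \<le> i + length u"
      using assms(2) by linarith
    define z where "z = take (j + length u - i) (drop i y)"
    have "j + length u \<le> length y"
      using j by (simp add: mem_occs_iff)
    then have len: "length z = j + length u - i"
      using \<open>i < j\<close> by (simp add: z_def)
    have "z \<in> W"
      using subword_mem[OF assms(3)] len \<open>i < j\<close> unfolding z_def by fastforce
    moreover have "periodic d z"
      unfolding z_def using periodic_overlapping_occs[OF assms(1) i j] \<open>i < j\<close> overlap by simp
    moreover have "take (length u) z = u"
    proof (rule nth_equalityI)
      show "length (take (length u) z) = length u"
        using len \<open>i < j\<close> by simp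
      fix k assume "k < length (take (length u) z)"
      then have "k < length u" "k < length z"
        by simp_all
      then show "take (length u) z ! k = u ! k"
        using i \<open>j + length u \<le> length y\<close> by (simp add: z_def mem_occs_iff)
    qed
    ultimately have "length z \<le> length u"
      by (rule maximal)
    then show False
      using len \<open>i < j\<close> by simp
  qed
qed

lemma uniformly_covers_if_all_periodic:
  assumes periodic: "\<And>x. x \<in> W \<Longrightarrow> periodic d x" and "w \<in> W" "d dvd length w"
  shows "uniformly_covers (1 / 2) w"
proof -
  let ?n = "length w"
  have n: "0 < ?n"
    using length_pos[OF assms(2)] .
  have "0 < d"
    using assms(3) n by (cases "d = 0") simp_all
  obtain N where N: "\<forall>y\<in>W. N \<le> length y \<longrightarrow> occs w y \<noteq> {}"
    using eventually_occurs[OF assms(2)] by blast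
  have "\<exists>m. disjoint_occs w y m \<and> 1 / 2 * length y \<le> real (m * ?n)"
    if y: "y \<in> W" "max N (2 * (d + ?n)) \<le> length y" for y
  proof -
    have "occs w y \<noteq> {}"
      using N y by simp
    then obtain t where t: "t \<in> occs w y"
      by blast
    define t0 where "t0 = t mod d"
    have "t0 \<in> occs w y" "t0 < d"
      using periodic_mod_mem_occs[OF periodic[OF y(1)] \<open>0 < d\<close> t] \<open>0 < d\<close>
      by (simp_all add: t0_def)
    define z where "z = drop t0 y"
    have "take ?n z = w" "t0 + ?n \<le> length y"
      using \<open>t0 \<in> occs w y\<close> by (simp_all add: occs_def z_def)
    have "periodic d z"
      unfolding z_def by (rule periodic_drop[OF periodic[OF y(1)]])
    define m where "m = length z div ?n"
    have "disjoint_occs w z m"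
      using disjoint_occs_periodic[OF \<open>periodic d z\<close> assms(3) n] \<open>take ?n z = w\<close>
      by (simp add: m_def)
    then have "disjoint_occs w y m"
      using disjoint_occs_append_left[of w z m "take t0 y"] by (simp add: z_def)
    moreover have "length y \<le> 2 * (m * ?n)"
      using le_two_mult_div_mult_drop[OF n \<open>t0 < d\<close>] y(2) by (simp add: m_def z_def mult.commute)
    then have "real (length y) \<le> real (2 * (m * ?n))"
      by (rule of_nat_mono)
    then have "1 / 2 * real (length y) \<le> real (m * ?n)"
      by simp
    ultimately show ?thesis
      by blast
  qed
  then show ?thesis
    unfolding uniformly_covers_def by blast
qed

lemma uniformly_covers_if_bounded_periodic:
  assumes "v \<in> W" "periodic d v" "2 * d \<le> length v" "d dvd n" "0 < n" "n \<le> length v"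
    and "\<And>z. z \<in> W \<Longrightarrow> periodic d z \<Longrightarrow> length z < B"
  shows "uniformly_covers (C / 4) (take n v)"
proof -
  obtain u where u: "u \<in> W" "periodic d u" "take (length v) u = v"
    and maximal: "\<And>z. z \<in> W \<Longrightarrow> periodic d z \<Longrightarrow> take (length u) z = u \<Longrightarrow> length z \<le> length u"
    using maximal_periodic_extension[OF assms(1,2,7)] by blast
  have "length v \<le> length u"
    using arg_cong[OF u(3), of length] by simp
  have "take n v = take n (take (length v) u)"
    using u(3) by simp
  also have "\<dots> = take n u"
    using assms(6) by (simp add: min.absorb1)
  finally have "take n u = take n v" ..
  have "uniformly_covers (C / real 2) u"
  proof (rule uniformly_covers_if_separated_occs[OF u(1)])
    show "length u \<le> 2 * (length u - d + 1)"
      using assms(3) \<open>length v \<le> length u\<close> by arith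
    show "separated (length u - d + 1) (occs u y)" if "y \<in> W" for y
      using u(2) assms(3) \<open>length v \<le> length u\<close> that maximal
      by (intro separated_occs_if_maximal_periodic) simp_all
  qed simp
  moreover have "disjoint_occs (take n v) u (length u div n)"
    using disjoint_occs_periodic[OF u(2) assms(4,5)] by (simp only: \<open>take n u = take n v\<close>)
  moreover have "length u \<le> 2 * (length u div n * length (take n v))"
    using le_two_mult_div_mult[OF assms(5), of "length u"] assms(6) \<open>length v \<le> length u\<close>
    by simp
  moreover have "take n v \<noteq> []"
    using assms(5,6) by auto
  ultimately have "uniformly_covers (C / real 2 / 2) (take n v)"
    by (intro uniformly_covers_trans)
  then show ?thesis
    by simp
qed

lemma uniformly_covers_periodic_prefix:
  assumes "v \<in> W" "periodic d v" "2 * d \<le> length v" "d dvd n" "0 < n" "n \<le> length v"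
  shows "uniformly_covers (C / 4) (take n v)"
proof (cases "\<exists>B. \<forall>z\<in>W. periodic d z \<longrightarrow> length z < B")
  case True
  then show ?thesis
    using uniformly_covers_if_bounded_periodic[OF assms] by blast
next
  case False
  then have "\<exists>z\<in>W. B \<le> length z \<and> periodic d z" for B
    by (meson not_less)
  then have "periodic d x" if "x \<in> W" for x
    using periodic_if_long_periodic that by blast
  moreover have "take n v \<in> W" "d dvd length (take n v)"
    using take_mem[OF assms(1,5)] assms(4,6) by simp_all
  ultimately have "uniformly_covers (1 / 2) (take n v)"
    by (rule uniformly_covers_if_all_periodic)
  then show ?thesis
    by (rule uniformly_covers_mono) (use C_le_1 in simp)
qed

text \<open>Either \<open>v\<close> has no period up to \<open>|v|/k\<close>, and then its occurrences are sparse, or it has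
  a small period \<open>d\<close>, and then the prefix whose length is a multiple of \<open>d\<close> is used.\<close>

lemma uniformly_covers_long_prefix:
  assumes "v \<in> W" "2 \<le> k"
  shows "\<exists>n. 0 < n \<and> n \<le> length v \<and> (length v - n) * k \<le> length v \<and>
    uniformly_covers (C / (4 * real k)) (take n v)"
proof (cases "\<exists>d. 0 < d \<and> d \<le> length v div k \<and> periodic d v")
  case False
  have "uniformly_covers (C / k) v"
  proof (rule uniformly_covers_if_separated_occs[OF assms(1)])
    have "length v = k * (length v div k) + length v mod k" "length v mod k < k"
      using assms(2) by simp_all
    then show "length v \<le> k * (length v div k + 1)"
      unfolding distrib_left mult_1_right by linarith
    show "separated (length v div k + 1) (occs v y)" for y
    proof (rule separated_occs_if_aperiodic)
      fix d' assume "0 < d'" "d' < length v div k + 1"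
      then show "\<not> periodic d' v"
        using False by (auto simp: less_Suc_eq_le)
    qed
  qed simp
  then have "uniformly_covers (C / (4 * real k)) v"
    by (rule uniformly_covers_mono) (use C_pos assms(2) in \<open>intro divide_left_mono, simp_all\<close>)
  then show ?thesis
    using length_pos[OF assms(1)] by (intro exI[of _ "length v"]) simp
next
  case True
  then obtain d where d: "0 < d" "d \<le> length v div k" "periodic d v"
    by blast
  define n where "n = length v div d * d"
  have n: "0 < n" "(length v - n) * k \<le> length v" "2 * d \<le> length v"
    using prefix_multiple_of_period[OF d(1,2) assms(2)] by (simp_all add: n_def)
  have "uniformly_covers (C / 4) (take n v)"
    using uniformly_covers_periodic_prefix[OF assms(1) d(3) n(3), of n] n(1) by (simp add: n_def)
  then have "uniformly_covers (C / (4 * real k)) (take n v)"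
    by (rule uniformly_covers_mono) (use C_pos assms(2) in \<open>intro divide_left_mono, simp_all\<close>)
  then show ?thesis
    using n(1,2) by (intro exI[of _ n]) (simp add: n_def)
qed

end

section \<open>A uniform subadditive theorem\<close>

locale subadditive_pw = pw_language W C for W :: "'a list set" and C +
  fixes F :: "'a list \<Rightarrow> real" and c :: real
  assumes F_Nil: "F [] = 0"
    and F_append_le: "F (x @ y) \<le> F x + F y"
    and F_le_append: "F x \<le> F (x @ y) + F y"
    and F_bound: "x \<in> W \<Longrightarrow> \<bar>F x\<bar> \<le> c * length x"
begin

lemma c_nonneg: "0 \<le> c"
proof -
  obtain x where "x \<in> W"
    using unbounded by blast
  then have "0 \<le> c * length x"
    using F_bound[of x] by linarith
  then show ?thesis
    using length_pos[OF \<open>x \<in> W\<close>] by (simp add: zero_le_mult_iff)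
qed

lemma F_le_if_mem_or_Nil:
  fixes \<alpha> D :: real
  assumes "x \<in> W \<or> x = []" "\<forall>g\<in>W. F g \<le> \<alpha> * length g + D" "0 \<le> D"
  shows "F x \<le> \<alpha> * length x + D"
  using assms F_Nil by auto

definition upper_slopes :: "real set" where
  "upper_slopes = {r. \<exists>D. \<forall>x\<in>W. F x \<le> r * length x + D}"

definition growth_rate :: real where
  "growth_rate = Inf upper_slopes"

lemma c_mem_upper_slopes: "c \<in> upper_slopes"
proof -
  have "F x \<le> c * length x + 0" if "x \<in> W" for x
    using F_bound[OF that] by simp
  then show ?thesis
    unfolding upper_slopes_def by blast
qed

lemma mem_upper_slopes_if_eventually:
  fixes r D :: real
  assumes "\<forall>x\<in>W. N \<le> length x \<longrightarrow> F x \<le> r * length x + D"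
  shows "r \<in> upper_slopes"
proof -
  have "F x \<le> r * length x + (\<bar>D\<bar> + \<bar>c - r\<bar> * N)" if "x \<in> W" for x
  proof (cases "N \<le> length x")
    case True
    then have "F x \<le> r * length x + D"
      using assms that by blast
    moreover have "0 \<le> \<bar>c - r\<bar> * N"
      by simp
    ultimately show ?thesis
      by linarith
  next
    case False
    have "F x \<le> r * length x + (c - r) * length x"
      using F_bound[OF that] by (simp add: algebra_simps abs_le_iff)
    moreover have "(c - r) * length x \<le> \<bar>c - r\<bar> * N"
      using False by (intro mult_mono) simp_all
    ultimately show ?thesis
      by linarith
  qed
  then show ?thesis
    unfolding upper_slopes_def by blast
qed

lemma upper_slopes_nonempty: "upper_slopes \<noteq> {}"
  using c_mem_upper_slopes by blast

lemma bdd_below_upper_slopes: "bdd_below upper_slopes"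
proof -
  have "- c \<le> r" if r: "r \<in> upper_slopes" for r
  proof (rule ccontr)
    assume "\<not> - c \<le> r"
    then have gap: "0 < - c - r"
      by simp
    obtain D where D: "\<forall>x\<in>W. F x \<le> r * length x + D"
      using r unfolding upper_slopes_def by blast
    obtain x where x: "x \<in> W" "nat \<lceil>(\<bar>D\<bar> + 1) / (- c - r)\<rceil> \<le> length x"
      using unbounded by blast
    then have "(\<bar>D\<bar> + 1) / (- c - r) \<le> length x"
      by simp
    then have "\<bar>D\<bar> + 1 \<le> (- c - r) * length x"
      using gap by (simp add: pos_divide_le_eq mult.commute)
    moreover have "(- c - r) * length x = - (c * length x) - r * length x"
      by (simp add: algebra_simps)
    moreover have "- (c * length x) \<le> F x"
      using F_bound[OF x(1)] by (simp add: abs_le_iff)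
    moreover have "F x \<le> r * length x + D"
      using D x(1) by blast
    ultimately show False
      by linarith
  qed
  then show ?thesis
    unfolding bdd_below_def by blast
qed

lemma growth_rate_le: "r \<in> upper_slopes \<Longrightarrow> growth_rate \<le> r"
  unfolding growth_rate_def by (rule cInf_lower[OF _ bdd_below_upper_slopes])

lemma growth_rate_upper_bound:
  assumes "0 < \<epsilon>"
  shows "\<exists>D\<ge>0. \<forall>x\<in>W. F x \<le> (growth_rate + \<epsilon>) * length x + D"
proof -
  have "Inf upper_slopes < growth_rate + \<epsilon>"
    using assms by (simp add: growth_rate_def)
  then obtain r where r: "r \<in> upper_slopes" "r < growth_rate + \<epsilon>"
    using cInf_less_iff[OF upper_slopes_nonempty bdd_below_upper_slopes] by blast
  then obtain D where D: "\<forall>x\<in>W. F x \<le> r * length x + D"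
    unfolding upper_slopes_def by blast
  have "F x \<le> (growth_rate + \<epsilon>) * length x + max D 0" if "x \<in> W" for x
  proof -
    have "r * length x \<le> (growth_rate + \<epsilon>) * length x"
      using r(2) by (intro mult_right_mono) simp_all
    moreover have "F x \<le> r * length x + D"
      using D that by blast
    ultimately show ?thesis
      by linarith
  qed
  then show ?thesis
    by (intro exI[of _ "max D 0"]) simp
qed

lemma F_le_disjoint_occs:
  fixes \<alpha> D :: real
  assumes "disjoint_occs w y m" "y \<in> W \<or> y = []"
    and bound: "\<forall>g\<in>W. F g \<le> \<alpha> * length g + D" and "0 \<le> D"
  shows "F y \<le> m * F w + \<alpha> * (real (length y) - real (m * length w)) + (real m + 1) * D"
  using assms(1,2)
proof (induction m arbitrary: y)
  case 0
  then show ?case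
    using F_le_if_mem_or_Nil[OF _ bound assms(4)] by simp
next
  case (Suc m)
  obtain i where i: "i + length w \<le> length y" "y = take i y @ w @ drop (i + length w) y"
    "disjoint_occs w (take i y) m"
    using disjoint_occs_SucE[OF Suc.prems(1)] by blast
  from Suc.IH[OF i(3) take_mem_or_Nil[OF Suc.prems(2)]]
  have IH: "F (take i y) \<le> m * F w + \<alpha> * (real i - real (m * length w)) + (real m + 1) * D"
    using i(1) by (simp add: min_absorb2)
  have "F (drop (i + length w) y) \<le> \<alpha> * length (drop (i + length w) y) + D"
    using F_le_if_mem_or_Nil[OF drop_mem_or_Nil[OF Suc.prems(2)] bound assms(4)] .
  then have rest: "F (drop (i + length w) y) \<le> \<alpha> * (real (length y) - real i - real (length w)) + D"
    using i(1) by (simp add: of_nat_diff algebra_simps)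
  have "F y \<le> F (take i y) + (F w + F (drop (i + length w) y))"
    using F_append_le[of "take i y" "w @ drop (i + length w) y"]
      F_append_le[of w "drop (i + length w) y"]
    by (subst i(2)) linarith
  then show ?case
    using IH rest by (simp add: algebra_simps)
qed

lemma F_le_if_covered:
  fixes \<Lambda> \<theta> \<delta> D :: real
  assumes "disjoint_occs w y m" "y \<in> W" "\<theta> * length y \<le> real (m * length w)"
    and Fw: "F w \<le> (\<Lambda> - \<delta>) * length w" and D_le: "D \<le> \<delta> / 2 * length w"
    and bound: "\<forall>x\<in>W. F x \<le> (\<Lambda> + \<theta> * \<delta> / 4) * length x + D" and "0 \<le> D" "0 \<le> \<delta>" "0 \<le> \<theta>"
  shows "F y \<le> (\<Lambda> - \<theta> * \<delta> / 4) * length y + D"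
proof -
  define \<epsilon> where "\<epsilon> = \<theta> * \<delta> / 4"
  define Y where "Y = real (length y)"
  define P where "P = real (m * length w)"
  have "F y \<le> m * F w + (\<Lambda> + \<epsilon>) * (Y - P) + (real m + 1) * D"
    using F_le_disjoint_occs[OF assms(1) _ bound assms(7)] assms(2) by (simp add: P_def Y_def \<epsilon>_def)
  moreover have "m * F w \<le> (\<Lambda> - \<delta>) * P"
    using mult_left_mono[OF Fw, of "real m"] by (simp add: P_def algebra_simps)
  moreover have "m * D \<le> \<delta> / 2 * P"
    using mult_left_mono[OF D_le, of "real m"] by (simp add: P_def algebra_simps)
  moreover have "(real m + 1) * D = m * D + D"
    by (simp add: algebra_simps)
  ultimately have "F y \<le> (\<Lambda> - \<delta>) * P + (\<Lambda> + \<epsilon>) * (Y - P) + \<delta> / 2 * P + D"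
    by linarith
  also have "\<dots> = \<Lambda> * Y + \<epsilon> * Y - \<epsilon> * P - \<delta> / 2 * P + D"
    by (simp add: algebra_simps)
  also have "\<dots> \<le> \<Lambda> * Y + \<epsilon> * Y - \<delta> / 2 * (\<theta> * Y) + D"
  proof -
    have "\<delta> / 2 * (\<theta> * Y) \<le> \<delta> / 2 * P"
      using assms(3,8) by (intro mult_left_mono) (simp_all add: P_def Y_def)
    moreover have "0 \<le> \<epsilon> * P"
      using assms(8,9) by (simp add: P_def \<epsilon>_def)
    ultimately show ?thesis
      by linarith
  qed
  also have "\<dots> = (\<Lambda> - \<epsilon>) * Y + D"
    by (simp add: \<epsilon>_def algebra_simps)
  finally show ?thesis
    by (simp add: Y_def \<epsilon>_def)
qed

lemma F_gt_if_uniformly_covers: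
  assumes "0 < \<theta>" "0 < \<delta>"
  shows "\<exists>L. \<forall>w. L \<le> length w \<longrightarrow> uniformly_covers \<theta> w \<longrightarrow> (growth_rate - \<delta>) * length w < F w"
proof -
  define \<epsilon> where "\<epsilon> = \<theta> * \<delta> / 4"
  have "0 < \<epsilon>"
    using assms by (simp add: \<epsilon>_def)
  obtain D where D: "0 \<le> D" "\<forall>x\<in>W. F x \<le> (growth_rate + \<epsilon>) * length x + D"
    using growth_rate_upper_bound[OF \<open>0 < \<epsilon>\<close>] by blast
  have "(growth_rate - \<delta>) * length w < F w"
    if w: "2 * D / \<delta> \<le> length w" "uniformly_covers \<theta> w" for w
  proof (rule ccontr)
    assume "\<not> (growth_rate - \<delta>) * length w < F w"
    then have Fw: "F w \<le> (growth_rate - \<delta>) * length w"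
      by simp
    have D_le: "D \<le> \<delta> / 2 * length w"
      using w(1) assms(2) by (simp add: pos_divide_le_eq mult.commute)
    obtain N where N: "\<forall>y\<in>W. N \<le> length y \<longrightarrow>
        (\<exists>m. disjoint_occs w y m \<and> \<theta> * length y \<le> real (m * length w))"
      using w(2) unfolding uniformly_covers_def by blast
    have "F y \<le> (growth_rate - \<epsilon>) * length y + D" if y: "y \<in> W" "N \<le> length y" for y
    proof -
      obtain m where m: "disjoint_occs w y m" "\<theta> * length y \<le> real (m * length w)"
        using N y by blast
      show ?thesis
        using F_le_if_covered[OF m(1) \<open>y \<in> W\<close> m(2) Fw D_le D(2)[unfolded \<epsilon>_def] D(1)] assms
        by (simp add: \<epsilon>_def)
    qed
    then have "growth_rate - \<epsilon> \<in> upper_slopes"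
      by (intro mem_upper_slopes_if_eventually) blast
    then have "growth_rate \<le> growth_rate - \<epsilon>"
      by (rule growth_rate_le)
    then show False
      using \<open>0 < \<epsilon>\<close> by simp
  qed
  then show ?thesis
    by (intro exI[of _ "nat \<lceil>2 * D / \<delta>\<rceil>"]) simp
qed

lemma eventually_F_le_growth_rate:
  assumes "0 < \<epsilon>"
  shows "\<exists>N. \<forall>x\<in>W. N \<le> length x \<longrightarrow> F x \<le> (growth_rate + \<epsilon>) * length x"
proof -
  obtain D where D: "0 \<le> D" "\<forall>x\<in>W. F x \<le> (growth_rate + \<epsilon> / 2) * length x + D"
    using growth_rate_upper_bound[of "\<epsilon> / 2"] assms by auto
  have "F x \<le> (growth_rate + \<epsilon>) * length x" if "x \<in> W" "2 * D / \<epsilon> \<le> length x" for x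
  proof -
    have "D \<le> \<epsilon> / 2 * length x"
      using that(2) assms by (simp add: pos_divide_le_eq mult.commute)
    moreover have "(growth_rate + \<epsilon>) * length x = (growth_rate + \<epsilon> / 2) * length x + \<epsilon> / 2 * length x"
      by (simp add: algebra_simps)
    moreover have "F x \<le> (growth_rate + \<epsilon> / 2) * length x + D"
      using D(2) that(1) by blast
    ultimately show ?thesis
      by linarith
  qed
  then show ?thesis
    by (intro exI[of _ "nat \<lceil>2 * D / \<epsilon>\<rceil>"]) simp
qed

lemma F_take_le:
  assumes "v \<in> W" "n \<le> length v"
  shows "F (take n v) \<le> F v + c * real (length v - n)"
proof -
  have "F (drop n v) \<le> c * real (length v - n)"
  proof (cases "drop n v = []")
    case True
    then show ?thesis
      using F_Nil c_nonneg by simp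
  next
    case False
    then have "drop n v \<in> W"
      using drop_mem[OF assms(1)] by fastforce
    then show ?thesis
      using F_bound[of "drop n v"] by simp
  qed
  then show ?thesis
    using F_le_append[of "take n v" "drop n v"] by simp
qed

text \<open>Cutting off a tail of relative length at most \<open>1/k\<close> costs at most \<open>c\<close> per letter, which for
  large \<open>k\<close> lowers the slope bound by less than \<open>\<delta>/2\<close>.\<close>

lemma F_take_le_slope:
  assumes "v \<in> W" "0 < \<delta>" "F v \<le> (growth_rate - \<delta>) * length v" "n \<le> length v"
    and "(length v - n) * k \<le> length v" "length v \<le> 2 * n" "8 * c \<le> \<delta> * k"
  shows "F (take n v) \<le> (growth_rate - \<delta> / 2) * n"
proof -
  define e where "e = real (length v - n)"
  have "0 \<le> e"
    by (simp add: e_def)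
  have v_eq: "real (length v) = n + e"
    using assms(4) by (simp add: e_def of_nat_diff)
  have "(growth_rate - \<delta> + c) * e \<le> 2 * c * e"
    using growth_rate_le[OF c_mem_upper_slopes] assms(2) \<open>0 \<le> e\<close> by (intro mult_right_mono) simp_all
  moreover have "4 * c * e \<le> \<delta> * n"
  proof (cases "k = 0")
    case True
    then show ?thesis
      using assms(2,7) c_nonneg \<open>0 \<le> e\<close> by simp
  next
    case False
    have "e * k \<le> length v"
      unfolding e_def using assms(5) by (metis of_nat_mono of_nat_mult)
    then have "4 * c * e * k \<le> 4 * c * length v"
      using c_nonneg by (simp add: mult.assoc mult_left_mono)
    also have "\<dots> \<le> 4 * c * (2 * real n)"
      using of_nat_mono[OF assms(6)] c_nonneg by (intro mult_left_mono) simp_all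
    also have "\<dots> \<le> \<delta> * n * k"
      using mult_right_mono[OF assms(7), of n] by (simp add: algebra_simps)
    finally show ?thesis
      using False by (simp add: mult.commute mult.left_commute)
  qed
  moreover have "(growth_rate - \<delta>) * length v = (growth_rate - \<delta>) * n + (growth_rate - \<delta> + c) * e - c * e"
    "(growth_rate - \<delta> / 2) * n = (growth_rate - \<delta>) * n + \<delta> * n / 2"
    using v_eq by (simp_all add: algebra_simps)
  ultimately show ?thesis
    using F_take_le[OF assms(1,4)] assms(3) unfolding e_def by linarith
qed

lemma eventually_growth_rate_le_F:
  assumes "0 < \<delta>"
  shows "\<exists>N. \<forall>x\<in>W. N \<le> length x \<longrightarrow> (growth_rate - \<delta>) * length x \<le> F x"
proof (rule ccontr)
  assume "\<not> ?thesis"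
  then have bad: "\<forall>N. \<exists>v\<in>W. N \<le> length v \<and> F v < (growth_rate - \<delta>) * length v"
    by (simp add: not_le)
  define k where "k = nat \<lceil>8 * c / \<delta>\<rceil> + 2"
  have "2 \<le> k"
    by (simp add: k_def)
  have "8 * c / \<delta> \<le> real k"
    unfolding k_def by linarith
  then have ck: "8 * c \<le> \<delta> * k"
    using assms by (simp add: pos_divide_le_eq mult.commute)
  define \<theta> where "\<theta> = C / (4 * real k)"
  have "0 < \<theta>"
    using C_pos \<open>2 \<le> k\<close> by (simp add: \<theta>_def)
  obtain L where L: "\<forall>w. L \<le> length w \<longrightarrow> uniformly_covers \<theta> w \<longrightarrow>
      (growth_rate - \<delta> / 2) * length w < F w"
    using F_gt_if_uniformly_covers[OF \<open>0 < \<theta>\<close>, of "\<delta> / 2"] assms by auto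
  obtain v where v: "v \<in> W" "2 * L \<le> length v" "F v < (growth_rate - \<delta>) * length v"
    using bad by blast
  obtain n where n: "0 < n" "n \<le> length v" "(length v - n) * k \<le> length v"
    "uniformly_covers \<theta> (take n v)"
    using uniformly_covers_long_prefix[OF v(1) \<open>2 \<le> k\<close>] unfolding \<theta>_def by blast
  have "(length v - n) * 2 \<le> length v"
    using n(3) \<open>2 \<le> k\<close> by (meson mult_le_mono2 order_trans)
  then have "length v \<le> 2 * n" "L \<le> n"
    using v(2) by linarith+
  then have "F (take n v) \<le> (growth_rate - \<delta> / 2) * n"
    using F_take_le_slope[OF v(1) assms _ n(2,3) _ ck] v(3) by simp
  moreover have "(growth_rate - \<delta> / 2) * n < F (take n v)"
    using L[rule_format, of "take n v"] n(2,4) \<open>L \<le> n\<close> by (simp add: min_absorb2)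
  ultimately show False
    by simp
qed

theorem uniform_growth_rate:
  assumes "0 < \<epsilon>"
  shows "\<exists>N. \<forall>x\<in>W. N \<le> length x \<longrightarrow> \<bar>F x / length x - growth_rate\<bar> \<le> \<epsilon>"
proof -
  obtain N1 where N1: "\<forall>x\<in>W. N1 \<le> length x \<longrightarrow> F x \<le> (growth_rate + \<epsilon>) * length x"
    using eventually_F_le_growth_rate[OF assms] by blast
  obtain N2 where N2: "\<forall>x\<in>W. N2 \<le> length x \<longrightarrow> (growth_rate - \<epsilon>) * length x \<le> F x"
    using eventually_growth_rate_le_F[OF assms] by blast
  have "\<bar>F x / length x - growth_rate\<bar> \<le> \<epsilon>" if "x \<in> W" "max N1 N2 \<le> length x" for x
  proof -
    have "0 < real (length x)"
      using length_pos[OF that(1)] by simp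
    moreover have "F x \<le> (growth_rate + \<epsilon>) * length x" "(growth_rate - \<epsilon>) * length x \<le> F x"
      using N1 N2 that by simp_all
    ultimately have "F x / length x \<le> growth_rate + \<epsilon>" "growth_rate - \<epsilon> \<le> F x / length x"
      by (simp_all add: pos_divide_le_eq pos_le_divide_eq)
    then show ?thesis
      unfolding abs_le_iff by linarith
  qed
  then show ?thesis
    by blast
qed

end

section \<open>Transfer matrices\<close>

abbreviation mnorm :: "real^2^2 \<Rightarrow> real" where
  "mnorm M \<equiv> onorm (\<lambda>x. M *v x)"

definition adj2 :: "real^2^2 \<Rightarrow> real^2^2" where
  "adj2 M = (\<chi> i j. if i = 1 \<and> j = 1 then M$2$2 else if i = 1 \<and> j = 2 then - M$1$2
     else if i = 2 \<and> j = 1 then - M$2$1 else M$1$1)"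

lemma adj2_nth: "adj2 M $ 1 $ 1 = M$2$2" "adj2 M $ 1 $ 2 = - M$1$2"
  "adj2 M $ 2 $ 1 = - M$2$1" "adj2 M $ 2 $ 2 = M$1$1"
  unfolding adj2_def by simp_all

lemma mat2_eqI:
  fixes A B :: "real^2^2"
  assumes "A $ 1 $ 1 = B $ 1 $ 1" "A $ 1 $ 2 = B $ 1 $ 2" "A $ 2 $ 1 = B $ 2 $ 1" "A $ 2 $ 2 = B $ 2 $ 2"
  shows "A = B"
  using assms by (simp add: vec_eq_iff forall_2)

lemma matrix_matrix_mult_nth_2:
  fixes A B :: "real^2^2"
  shows "(A ** B) $ i $ j = A $ i $ 1 * B $ 1 $ j + A $ i $ 2 * B $ 2 $ j"
  by (simp add: matrix_matrix_mult_def sum_2)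

lemma mat1_nth_2: "(mat 1 :: real^2^2) $ 1 $ 1 = 1" "(mat 1 :: real^2^2) $ 1 $ 2 = 0"
  "(mat 1 :: real^2^2) $ 2 $ 1 = 0" "(mat 1 :: real^2^2) $ 2 $ 2 = 1"
  by (simp_all add: mat_def)

lemma adj2_mult: "det M = 1 \<Longrightarrow> adj2 M ** M = mat 1"
  by (rule mat2_eqI) (simp_all add: matrix_matrix_mult_nth_2 adj2_nth mat1_nth_2 det_2 algebra_simps)

lemma mult_adj2: "det M = 1 \<Longrightarrow> M ** adj2 M = mat 1"
  by (rule mat2_eqI) (simp_all add: matrix_matrix_mult_nth_2 adj2_nth mat1_nth_2 det_2 algebra_simps)

lemma adj2_adj2 [simp]: "adj2 (adj2 M) = M"
  by (rule mat2_eqI) (simp_all add: adj2_nth)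

lemma left_inverse_eq_adj2:
  assumes "det M = 1" "N ** M = mat 1"
  shows "N = adj2 M"
proof -
  have "N = N ** (M ** adj2 M)"
    using mult_adj2[OF assms(1)] by simp
  also have "\<dots> = adj2 M"
    using assms(2) by (simp add: matrix_mul_assoc)
  finally show ?thesis .
qed

lemma matrix_inv_eq_adj2:
  assumes "det M = 1"
  shows "matrix_inv M = adj2 M"
proof -
  have "\<exists>N. M ** N = mat 1 \<and> N ** M = mat 1"
    using adj2_mult[OF assms] mult_adj2[OF assms] by blast
  then have "matrix_inv M ** M = mat 1"
    unfolding matrix_inv_def by (rule someI2_ex) blast
  then show ?thesis
    using left_inverse_eq_adj2[OF assms] by blast
qed

lemma mnorm_mult_le: "mnorm (A ** B) \<le> mnorm A * mnorm B"
proof -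
  have "mnorm (A ** B) = onorm ((\<lambda>x. A *v x) \<circ> (\<lambda>x. B *v x))"
    by (simp add: o_def matrix_vector_mul_assoc)
  also have "\<dots> \<le> mnorm A * mnorm B"
    by (rule onorm_compose[OF matrix_vector_mul_bounded_linear matrix_vector_mul_bounded_linear])
  finally show ?thesis .
qed

lemma mnorm_mat1: "mnorm (mat 1) = 1"
  using onorm_id by simp

lemma mnorm_nonneg: "0 \<le> mnorm M"
  by (rule onorm_pos_le[OF matrix_vector_mul_bounded_linear])

lemma mnorm_le_entries: "mnorm M \<le> \<bar>M$1$1\<bar> + \<bar>M$1$2\<bar> + \<bar>M$2$1\<bar> + \<bar>M$2$2\<bar>"
  using onorm_le_matrix_component_sum[of M] by (simp add: sum_2)

lemma entries_le_mnorm: "\<bar>M$1$1\<bar> + \<bar>M$1$2\<bar> + \<bar>M$2$1\<bar> + \<bar>M$2$2\<bar> \<le> 4 * mnorm M"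
  using matrix_component_le_onorm[of M 1 1] matrix_component_le_onorm[of M 1 2]
    matrix_component_le_onorm[of M 2 1] matrix_component_le_onorm[of M 2 2]
  by linarith

lemma mnorm_adj2_le: "mnorm (adj2 M) \<le> 4 * mnorm M"
  using mnorm_le_entries[of "adj2 M"] entries_le_mnorm[of M] by (simp add: adj2_nth)

lemma mnorm_ge_if_det1:
  assumes "det M = 1"
  shows "1 / 2 \<le> mnorm M"
proof -
  have "1 = mnorm (adj2 M ** M)"
    using adj2_mult[OF assms] mnorm_mat1 by simp
  also have "\<dots> \<le> mnorm (adj2 M) * mnorm M"
    by (rule mnorm_mult_le)
  also have "\<dots> \<le> 4 * mnorm M * mnorm M"
    using mnorm_adj2_le[of M] mnorm_nonneg[of M] by (intro mult_right_mono)
  finally have "1 \<le> (2 * mnorm M)\<^sup>2"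
    by (simp add: power2_eq_square)
  then have "1 \<le> 2 * mnorm M"
    using power2_le_imp_le[of 1 "2 * mnorm M"] mnorm_nonneg[of M] by simp
  then show ?thesis
    by simp
qed

definition transfer_letter :: "real \<Rightarrow> real \<Rightarrow> real^2^2" where
  "transfer_letter E a = transfer E (\<lambda>_. a)"

primrec transfer_word :: "real \<Rightarrow> real list \<Rightarrow> real^2^2" where
  "transfer_word E [] = mat 1"
| "transfer_word E (a # xs) = transfer_word E xs ** transfer_letter E a"

lemma transfer_letter_nth: "transfer_letter E a $ 1 $ 1 = E - a" "transfer_letter E a $ 1 $ 2 = -1"
  "transfer_letter E a $ 2 $ 1 = 1" "transfer_letter E a $ 2 $ 2 = 0"
  unfolding transfer_letter_def transfer_def by simp_all

lemma det_transfer_letter: "det (transfer_letter E a) = 1"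
  by (simp add: det_2 transfer_letter_nth)

lemma transfer_word_append: "transfer_word E (xs @ ys) = transfer_word E ys ** transfer_word E xs"
  by (induction xs) (simp_all add: matrix_mul_assoc)

lemma det_transfer_word: "det (transfer_word E xs) = 1"
  by (induction xs) (simp_all add: det_mul det_transfer_letter)

lemma mnorm_transfer_word_pos: "0 < mnorm (transfer_word E xs)"
  using mnorm_ge_if_det1[OF det_transfer_word, of E xs] by linarith

lemma mnorm_transfer_word_le:
  assumes "\<forall>a\<in>set xs. \<bar>a\<bar> \<le> B"
  shows "mnorm (transfer_word E xs) \<le> (\<bar>E\<bar> + B + 2) ^ length xs"
  using assms
proof (induction xs)
  case Nil
  then show ?case
    using mnorm_mat1 by simp
next
  case (Cons a xs)
  have "\<bar>a\<bar> \<le> B"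
    using Cons.prems by simp
  then have "0 \<le> B"
    using abs_ge_zero[of a] by linarith
  have "mnorm (transfer_letter E a) \<le> \<bar>E - a\<bar> + 2"
    using mnorm_le_entries[of "transfer_letter E a"] by (simp add: transfer_letter_nth)
  also have "\<dots> \<le> \<bar>E\<bar> + B + 2"
    using Cons.prems abs_triangle_ineq4[of E a] by simp
  finally have "mnorm (transfer_letter E a) \<le> \<bar>E\<bar> + B + 2" .
  moreover have "mnorm (transfer_word E xs) \<le> (\<bar>E\<bar> + B + 2) ^ length xs"
    using Cons by simp
  ultimately have "mnorm (transfer_word E xs) * mnorm (transfer_letter E a)
      \<le> (\<bar>E\<bar> + B + 2) ^ length xs * (\<bar>E\<bar> + B + 2)"
    using mnorm_nonneg \<open>0 \<le> B\<close> by (intro mult_mono) simp_all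
  then show ?case
    using mnorm_mult_le[of "transfer_word E xs" "transfer_letter E a"] by (simp add: mult.commute)
qed

text \<open>The factor 4 absorbs the constant in the bound for the adjugate, so that \<open>log_norm\<close>
  is nonnegative, subadditive, and satisfies the reverse inequality needed in \<open>subadditive_pw\<close>.\<close>

definition log_norm :: "real \<Rightarrow> real list \<Rightarrow> real" where
  "log_norm E xs = (if xs = [] then 0 else ln (4 * mnorm (transfer_word E xs)))"

lemma log_norm_nonneg: "0 \<le> log_norm E xs"
  using mnorm_ge_if_det1[OF det_transfer_word, of E xs] by (simp add: log_norm_def)

lemma ln_mnorm_mult_le:
  "ln (4 * mnorm (A ** B)) \<le> ln (4 * mnorm A) + ln (4 * mnorm B)"
  if "0 < mnorm (A ** B)" "0 < mnorm A" "0 < mnorm B" for A B :: "real^2^2"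
proof -
  have "4 * mnorm (A ** B) \<le> (4 * mnorm A) * (4 * mnorm B)"
    using mnorm_mult_le[of A B] that by simp
  then have "ln (4 * mnorm (A ** B)) \<le> ln ((4 * mnorm A) * (4 * mnorm B))"
    using that by simp
  also have "\<dots> = ln (4 * mnorm A) + ln (4 * mnorm B)"
    using that by (intro ln_mult_pos) simp_all
  finally show ?thesis .
qed

lemma log_norm_append_le: "log_norm E (xs @ ys) \<le> log_norm E xs + log_norm E ys"
proof (cases "xs = [] \<or> ys = []")
  case False
  have "log_norm E (xs @ ys) = ln (4 * mnorm (transfer_word E ys ** transfer_word E xs))"
    using False by (simp add: log_norm_def transfer_word_append)
  also have "\<dots> \<le> ln (4 * mnorm (transfer_word E ys)) + ln (4 * mnorm (transfer_word E xs))"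
    using mnorm_transfer_word_pos[of E "xs @ ys"]
    by (intro ln_mnorm_mult_le) (simp_all add: mnorm_transfer_word_pos transfer_word_append)
  also have "\<dots> = log_norm E xs + log_norm E ys"
    using False by (simp add: log_norm_def)
  finally show ?thesis .
qed (auto simp: log_norm_def)

lemma log_norm_le_append: "log_norm E xs \<le> log_norm E (xs @ ys) + log_norm E ys"
proof (cases "xs = [] \<or> ys = []")
  case False
  let ?a = "mnorm (transfer_word E xs)" and ?b = "mnorm (transfer_word E (xs @ ys))"
    and ?c = "mnorm (transfer_word E ys)"
  have "transfer_word E xs = adj2 (transfer_word E ys) ** transfer_word E (xs @ ys)"
    by (simp add: transfer_word_append matrix_mul_assoc adj2_mult[OF det_transfer_word])
  then have "?a \<le> mnorm (adj2 (transfer_word E ys)) * ?b"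
    using mnorm_mult_le by metis
  also have "\<dots> \<le> (4 * ?c) * ?b"
    using mnorm_adj2_le mnorm_nonneg by (intro mult_right_mono)
  finally have "4 * ?a \<le> (4 * ?b) * (4 * ?c)"
    by simp
  then have "ln (4 * ?a) \<le> ln ((4 * ?b) * (4 * ?c))"
    using mnorm_transfer_word_pos by simp
  also have "\<dots> = ln (4 * ?b) + ln (4 * ?c)"
    using mnorm_transfer_word_pos by (intro ln_mult_pos) simp_all
  finally show ?thesis
    using False by (simp add: log_norm_def)
qed (use log_norm_nonneg[of E ys] in \<open>auto simp: log_norm_def\<close>)

lemma log_norm_le:
  assumes "\<forall>a\<in>set xs. \<bar>a\<bar> \<le> B" "0 \<le> B"
  shows "log_norm E xs \<le> ln (4 * (\<bar>E\<bar> + B + 2)) * length xs"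
proof (cases "xs = []")
  case False
  let ?K = "\<bar>E\<bar> + B + 2"
  have "0 < ?K"
    using assms(2) by simp
  have "1 \<le> real (length xs)"
    using False by (simp add: Suc_le_eq)
  have "4 * mnorm (transfer_word E xs) \<le> 4 * ?K ^ length xs"
    using mnorm_transfer_word_le[OF assms(1)] by simp
  then have "ln (4 * mnorm (transfer_word E xs)) \<le> ln (4 * ?K ^ length xs)"
    using mnorm_transfer_word_pos \<open>0 < ?K\<close> by simp
  also have "\<dots> = ln 4 + length xs * ln ?K"
    using \<open>0 < ?K\<close> by (simp add: ln_mult_pos ln_realpow)
  also have "\<dots> \<le> ln 4 * length xs + length xs * ln ?K"
    using \<open>1 \<le> real (length xs)\<close> by simp
  also have "\<dots> = (ln 4 + ln ?K) * length xs"
    by (simp add: algebra_simps)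
  also have "\<dots> = ln (4 * ?K) * length xs"
    using ln_mult_pos[of 4 ?K] \<open>0 < ?K\<close> by simp
  finally show ?thesis
    using False by (simp add: log_norm_def)
qed (simp add: log_norm_def)

section \<open>Subshifts and the cocycle\<close>

lemma length_word_at [simp]: "length (word_at \<omega> m n) = n"
  by (simp add: word_at_def)

lemma nth_word_at [simp]: "j < n \<Longrightarrow> word_at \<omega> m n ! j = \<omega> (m + int j)"
  by (simp add: word_at_def)

lemma word_at_Suc: "word_at \<omega> m (Suc n) = word_at \<omega> m n @ [\<omega> (m + int n)]"
  by (simp add: word_at_def)

lemma word_at_Suc_Cons: "word_at \<omega> m (Suc n) = \<omega> m # word_at \<omega> (m + 1) n"
  by (rule nth_equalityI) (auto simp: nth_Cons add.assoc split: nat.splits)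

lemma transfer_shiftpow: "transfer E (shiftpow k \<omega>) = transfer_letter E (\<omega> (1 + k))"
  by (simp add: transfer_letter_def transfer_def shiftpow_def add.commute)

lemma cocycle_pos_eq: "cocycle_pos E n \<omega> = transfer_word E (word_at \<omega> 1 n)"
  by (induction n) (simp_all add: word_at_Suc transfer_word_append transfer_shiftpow word_at_def)

lemma cocycle_neg_eq: "cocycle_neg E k \<omega> = adj2 (transfer_word E (word_at \<omega> (1 - int k) k))"
proof (rule left_inverse_eq_adj2[OF det_transfer_word])
  show "cocycle_neg E k \<omega> ** transfer_word E (word_at \<omega> (1 - int k) k) = mat 1"
  proof (induction k)
    case (Suc k)
    have "word_at \<omega> (1 - int (Suc k)) (Suc k) = \<omega> (- int k) # word_at \<omega> (1 - int k) k"
      by (simp add: word_at_Suc_Cons)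
    moreover have "transfer E (shiftpow (- int (Suc k)) \<omega>) = transfer_letter E (\<omega> (- int k))"
      by (simp add: transfer_shiftpow)
    ultimately have "cocycle_neg E (Suc k) \<omega> ** transfer_word E (word_at \<omega> (1 - int (Suc k)) (Suc k))
        = adj2 (transfer_letter E (\<omega> (- int k))) **
          ((cocycle_neg E k \<omega> ** transfer_word E (word_at \<omega> (1 - int k) k)) ** transfer_letter E (\<omega> (- int k)))"
      by (simp add: matrix_inv_eq_adj2[OF det_transfer_letter] matrix_mul_assoc)
    then show ?case
      using Suc by (simp add: adj2_mult[OF det_transfer_letter])
  qed (simp add: word_at_def)
qed

text \<open>The word read by \<open>M\<^sup>E(n, \<omega>)\<close>: positions \<open>1..n\<close> for \<open>n \<ge> 0\<close> and \<open>n+1..0\<close> for \<open>n < 0\<close>.\<close>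

definition cocycle_word :: "(int \<Rightarrow> real) \<Rightarrow> int \<Rightarrow> real list" where
  "cocycle_word \<omega> n = (if 0 \<le> n then word_at \<omega> 1 (nat n) else word_at \<omega> (1 + n) (nat (- n)))"

lemma length_cocycle_word: "length (cocycle_word \<omega> n) = nat \<bar>n\<bar>"
  by (simp add: cocycle_word_def)

lemma cocycle_eq_transfer_word:
  "cocycle E n \<omega> = (if 0 \<le> n then transfer_word E (cocycle_word \<omega> n)
     else adj2 (transfer_word E (cocycle_word \<omega> n)))"
  by (simp add: cocycle_def cocycle_word_def cocycle_pos_eq cocycle_neg_eq)

lemma det_adj2: "det (adj2 M) = det M"
  by (simp add: det_2 adj2_nth mult.commute)

lemma ln_mnorm_adj2_bounds:
  assumes "det M = 1"
  shows "\<bar>ln (mnorm (adj2 M)) - ln (mnorm M)\<bar> \<le> ln 4"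
proof -
  have "0 < mnorm M" "0 < mnorm (adj2 M)"
    using mnorm_ge_if_det1[OF assms] mnorm_ge_if_det1[of "adj2 M"] assms
    by (simp_all add: det_adj2)
  moreover have "mnorm (adj2 M) \<le> 4 * mnorm M" "mnorm M \<le> 4 * mnorm (adj2 M)"
    using mnorm_adj2_le[of M] mnorm_adj2_le[of "adj2 M"] by simp_all
  ultimately have "ln (mnorm (adj2 M)) \<le> ln 4 + ln (mnorm M)" "ln (mnorm M) \<le> ln 4 + ln (mnorm (adj2 M))"
    by (simp_all flip: ln_mult_pos)
  then show ?thesis
    by linarith
qed

lemma ln_mnorm_cocycle_approx:
  "\<bar>ln (mnorm (cocycle E n \<omega>)) - log_norm E (cocycle_word \<omega> n)\<bar> \<le> 2 * ln 4"
proof (cases "n = 0")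
  case True
  then show ?thesis
    by (simp add: cocycle_def cocycle_word_def log_norm_def word_at_def onorm_id)
next
  case False
  let ?M = "transfer_word E (cocycle_word \<omega> n)"
  have "cocycle_word \<omega> n \<noteq> []"
    using False length_cocycle_word[of \<omega> n] by auto
  then have "log_norm E (cocycle_word \<omega> n) = ln 4 + ln (mnorm ?M)"
    using mnorm_transfer_word_pos[of E "cocycle_word \<omega> n"] by (simp add: log_norm_def ln_mult_pos)
  then show ?thesis
    using ln_mnorm_adj2_bounds[OF det_transfer_word, of E "cocycle_word \<omega> n"]
    by (auto simp: cocycle_eq_transfer_word abs_le_iff)
qed

lemma word_at_mem_subwords: "\<omega> \<in> \<Omega> \<Longrightarrow> 0 < n \<Longrightarrow> word_at \<omega> m n \<in> subwords \<Omega>"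
  unfolding subwords_def by fastforce

lemma cocycle_word_mem_subwords: "\<omega> \<in> \<Omega> \<Longrightarrow> n \<noteq> 0 \<Longrightarrow> cocycle_word \<omega> n \<in> subwords \<Omega>"
  by (simp add: cocycle_word_def word_at_mem_subwords)

lemma subwords_take_drop:
  assumes "x \<in> subwords \<Omega>" "take n (drop i x) \<noteq> []"
  shows "take n (drop i x) \<in> subwords \<Omega>"
proof -
  obtain \<omega> m k where x: "x = word_at \<omega> m k" "\<omega> \<in> \<Omega>"
    using assms(1) unfolding subwords_def by blast
  have "take n (drop i x) = word_at \<omega> (m + int i) (min n (k - i))"
    by (rule nth_equalityI) (auto simp: x(1) add.assoc)
  moreover have "0 < min n (k - i)"
    using assms(2) x(1) by (simp add: min_def)
  ultimately show ?thesis
    using word_at_mem_subwords[OF x(2)] by simp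
qed

lemma factorial_language_subwords:
  assumes "\<Omega> \<noteq> {}"
  shows "factorial_language (subwords \<Omega>)"
proof
  obtain \<omega> where "\<omega> \<in> \<Omega>"
    using assms by blast
  then show "\<exists>x\<in>subwords \<Omega>. n \<le> length x" for n
    using word_at_mem_subwords[of \<omega> \<Omega> "Suc n" 0] by force
  show "[] \<notin> subwords \<Omega>"
    by (auto simp: subwords_def word_at_def)
qed (rule subwords_take_drop)

text \<open>(PW) with constant \<open>C\<close> yields the occurrence density \<open>min (C/2) 1\<close>.\<close>

lemma pw_language_subwords:
  assumes "\<Omega> \<noteq> {}" "PW \<Omega>"
  shows "\<exists>C. pw_language (subwords \<Omega>) C"
proof -
  interpret factorial_language "subwords \<Omega>"
    by (rule factorial_language_subwords[OF assms(1)])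
  obtain C where C: "0 < C" and PWC: "\<forall>v\<in>subwords \<Omega>. \<forall>\<epsilon>>0. \<exists>N. \<forall>x\<in>subwords \<Omega>. length x \<ge> N \<longrightarrow>
      real (occurrences v x) / real (length x) * real (length v) \<ge> C - \<epsilon>"
    using assms(2) unfolding PW_def by (elim exE conjE) blast
  have "\<exists>N. \<forall>x\<in>subwords \<Omega>. N \<le> length x \<longrightarrow>
      min (C / 2) 1 * length x \<le> real (card (occs v x) * length v)" if v: "v \<in> subwords \<Omega>" for v
  proof -
    obtain N where N: "\<forall>x\<in>subwords \<Omega>. N \<le> length x \<longrightarrow>
        C - C / 2 \<le> real (occurrences v x) / real (length x) * real (length v)"
      using PWC[rule_format, OF v half_gt_zero[OF C]] by (elim exE) simp
    have "min (C / 2) 1 * length x \<le> real (card (occs v x) * length v)"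
      if "x \<in> subwords \<Omega>" "N \<le> length x" for x
    proof -
      have "0 < real (length x)"
        using length_pos[OF that(1)] by simp
      moreover have "C / 2 \<le> real (card (occs v x)) / real (length x) * real (length v)"
        using N that by (simp add: occurrences_eq_card_occs)
      ultimately have "C / 2 * length x \<le> real (card (occs v x)) * real (length v)"
        by (simp add: field_simps)
      then have "C / 2 * length x \<le> real (card (occs v x) * length v)"
        by simp
      moreover have "min (C / 2) 1 * length x \<le> C / 2 * length x"
        by (intro mult_right_mono) simp_all
      ultimately show ?thesis
        by linarith
    qed
    then show ?thesis
      by blast
  qed
  moreover have "0 < min (C / 2) 1" "min (C / 2) 1 \<le> 1"
    using C by simp_all
  ultimately have "pw_language (subwords \<Omega>) (min (C / 2) 1)"
    by (intro pw_language.intro pw_language_axioms.intro factorial_language_subwords[OF assms(1)])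
  then show ?thesis ..
qed

lemma subadditive_pw_log_norm:
  assumes "finite A" "subshift A \<Omega>" "pw_language (subwords \<Omega>) C"
  shows "subadditive_pw (subwords \<Omega>) C (log_norm E) (ln (4 * (\<bar>E\<bar> + (\<Sum>a\<in>A. \<bar>a\<bar>) + 2)))"
proof -
  interpret pw_language "subwords \<Omega>" C
    by (rule assms(3))
  let ?B = "\<Sum>a\<in>A. \<bar>a\<bar>"
  have "0 \<le> ?B"
    by (simp add: sum_nonneg)
  have "\<forall>a\<in>set x. \<bar>a\<bar> \<le> ?B" if x: "x \<in> subwords \<Omega>" for x
  proof
    fix a assume "a \<in> set x"
    obtain \<omega> m k where "x = word_at \<omega> m k" "\<omega> \<in> \<Omega>"
      using x unfolding subwords_def by blast
    then obtain j where "a = \<omega> (m + int j)"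
      using \<open>a \<in> set x\<close> by (auto simp: word_at_def)
    then have "a \<in> A"
      using \<open>\<omega> \<in> \<Omega>\<close> assms(2) unfolding subshift_def by blast
    then show "\<bar>a\<bar> \<le> ?B"
      using assms(1) by (intro member_le_sum) simp_all
  qed
  then show ?thesis
    using log_norm_le[OF _ \<open>0 \<le> ?B\<close>] log_norm_nonneg
    by (intro subadditive_pw.intro[OF assms(3)] subadditive_pw_axioms.intro)
      (simp_all add: log_norm_append_le log_norm_le_append, simp add: log_norm_def)
qed

lemma eventually_sup_at_top_at_bot:
  assumes "\<And>n::int. N \<le> \<bar>n\<bar> \<Longrightarrow> P n"
  shows "eventually P (sup at_top at_bot)"
proof -
  have "P n" if "\<bar>N\<bar> \<le> n" for n
    using that abs_ge_self[of N] abs_ge_self[of n] by (intro assms) linarith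
  moreover have "P n" if "n \<le> - \<bar>N\<bar>" for n
    using that abs_ge_self[of N] abs_ge_minus_self[of n] by (intro assms) linarith
  ultimately show ?thesis
    unfolding eventually_sup eventually_at_top_linorder eventually_at_bot_linorder by blast
qed

lemma uniform_cocycle_if_log_norm_converges:
  assumes "\<And>\<epsilon>. 0 < \<epsilon> \<Longrightarrow> \<exists>N. \<forall>x\<in>subwords \<Omega>. N \<le> length x \<longrightarrow>
      \<bar>log_norm E x / length x - \<Lambda>\<bar> \<le> \<epsilon>"
  shows "uniform_cocycle \<Omega> E"
  unfolding uniform_cocycle_def uniform_limit_iff
proof (intro exI[of _ "\<lambda>_. \<Lambda>"] allI impI)
  fix e :: real assume "0 < e"
  then obtain N where N: "\<forall>x\<in>subwords \<Omega>. N \<le> length x \<longrightarrow> \<bar>log_norm E x / length x - \<Lambda>\<bar> \<le> e / 2"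
    using assms[of "e / 2"] by auto
  show "\<forall>\<^sub>F n in sup at_top at_bot. \<forall>\<omega>\<in>\<Omega>.
      dist (ln (mnorm (cocycle E n \<omega>)) / real_of_int \<bar>n\<bar>) \<Lambda> < e"
  proof (rule eventually_sup_at_top_at_bot)
    fix n :: int assume n: "max (int N) (\<lceil>4 * ln 4 / e\<rceil> + 1) \<le> \<bar>n\<bar>"
    define t where "t = real_of_int \<bar>n\<bar>"
    have "4 * ln 4 / e < t"
      using n unfolding t_def by linarith
    moreover have "0 < 4 * ln 4 / e"
      using \<open>0 < e\<close> by simp
    ultimately have "0 < t"
      by linarith
    then have "2 * ln 4 / t < e / 2"
      using \<open>4 * ln 4 / e < t\<close> \<open>0 < e\<close> by (simp add: field_simps)
    show "\<forall>\<omega>\<in>\<Omega>. dist (ln (mnorm (cocycle E n \<omega>)) / real_of_int \<bar>n\<bar>) \<Lambda> < e"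
    proof
      fix \<omega> assume "\<omega> \<in> \<Omega>"
      let ?x = "cocycle_word \<omega> n" and ?l = "ln (mnorm (cocycle E n \<omega>))"
      have "real (length ?x) = t" "N \<le> length ?x"
        using n by (simp_all add: t_def length_cocycle_word le_nat_iff)
      moreover have "?x \<in> subwords \<Omega>"
        using cocycle_word_mem_subwords[OF \<open>\<omega> \<in> \<Omega>\<close>] \<open>0 < t\<close> by (simp add: t_def)
      ultimately have "\<bar>log_norm E ?x / t - \<Lambda>\<bar> \<le> e / 2"
        using N by fastforce
      moreover have "\<bar>?l / t - log_norm E ?x / t\<bar> \<le> 2 * ln 4 / t"
        using ln_mnorm_cocycle_approx[of E n \<omega>] \<open>0 < t\<close>
        by (simp add: diff_divide_distrib[symmetric] divide_right_mono)
      moreover have "dist (?l / t) \<Lambda> \<le> dist (?l / t) (log_norm E ?x / t) + dist (log_norm E ?x / t) \<Lambda>"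
        by (rule dist_triangle)
      ultimately show "dist (?l / real_of_int \<bar>n\<bar>) \<Lambda> < e"
        using \<open>2 * ln 4 / t < e / 2\<close> unfolding dist_real_def t_def[symmetric] by linarith
    qed
  qed
qed

theorem theorem2p5:
  fixes A :: "real set" and \<Omega> :: "(int \<Rightarrow> real) set"
  assumes "finite A" and "subshift A \<Omega>" and "PW \<Omega>"
  shows "\<forall>E::real. uniform_cocycle \<Omega> E"
proof
  fix E :: real
  show "uniform_cocycle \<Omega> E"
  proof (cases "\<Omega> = {}")
    case True
    then show ?thesis
      by (simp add: uniform_cocycle_def uniform_limit_iff)
  next
    case False
    then obtain C where "pw_language (subwords \<Omega>) C"
      using pw_language_subwords assms(3) by blast
    then interpret subadditive_pw "subwords \<Omega>" C "log_norm E" "ln (4 * (\<bar>E\<bar> + (\<Sum>a\<in>A. \<bar>a\<bar>) + 2))"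
      by (rule subadditive_pw_log_norm[OF assms(1,2)])
    show ?thesis
      using uniform_growth_rate by (rule uniform_cocycle_if_log_norm_converges)
  qed
qed

end
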